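(* Let $1<k<n$. There does not exist an entire, convex, spacelike hypersurface $\mathcal{M}_u=\{(x,u(x)) : x\in\mathbb{R}^n\}$ in the Minkowski space $\mathbb{R}^{n,1}$ satisfying $$\sigma_k(\kappa[\mathcal{M}_u])=\binom{n}{k}$$ which is strictly spacelike, i.e. for which there is a constant $\beta<1$ such that $|Du(x)|\le\beta<1$ for all $x\in\mathbb{R}^n$.
   Context: $\mathbb{R}^{n,1}$ is $\mathbb{R}^{n+1}$ with the Lorentzian metric $ds^2=\sum_{i=1}^n dx_i^2-dx_{n+1}^2$. $\sigma_k$ is the $k$-th elementary symmetric polynomial. A graph $\mathcal{M}_u$ of a (smooth) function $u$ is spacelike if $|Du|<1$. Its principal curvatures $\kappa[\mathcal{M}_u]=(\kappa_1,\dots,\kappa_n)$ are the eigenvalues of the second fundamental form $h_{ij}=\frac{u_{x_ix_j}}{\sqrt{1-|Du|^2}}$ with respect to the induced metric $g_{ij}=\delta_{ij}-u_{x_i}u_{x_j}$. Convex means all principal curvatures are nonnegative. *)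

theory Defs
  imports "HOL-Analysis.Analysis" "HOL-Computational_Algebra.Polynomial"
begin

definition partial_deriv :: "'n::finite \<Rightarrow> (real^'n \<Rightarrow> real) \<Rightarrow> real^'n \<Rightarrow> real" where
  "partial_deriv i f x = frechet_derivative f (at x) (axis i 1)"

primrec C_k :: "nat \<Rightarrow> (real^'n::finite \<Rightarrow> real) \<Rightarrow> bool" where
  "C_k 0 f \<longleftrightarrow> continuous_on UNIV f"
| "C_k (Suc m) f \<longleftrightarrow> (\<forall>x. f differentiable (at x)) \<and> (\<forall>i. C_k m (partial_deriv i f))"

definition smooth :: "(real^'n::finite \<Rightarrow> real) \<Rightarrow> bool" where
  "smooth f \<longleftrightarrow> (\<forall>m. C_k m f)"

definition gradient :: "(real^'n::finite \<Rightarrow> real) \<Rightarrow> real^'n \<Rightarrow> real^'n" where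
  "gradient u x = (\<chi> i. partial_deriv i u x)"

text \<open>The graph of \<open>u\<close> in Minkowski space is represented by the function \<open>u\<close> itself; being
  defined on all of \<open>real^'n\<close>, it gives an entire graph.\<close>

definition spacelike :: "(real^'n::finite \<Rightarrow> real) \<Rightarrow> bool" where
  "spacelike u \<longleftrightarrow> (\<forall>x. norm (gradient u x) < 1)"

definition strictly_spacelike :: "(real^'n::finite \<Rightarrow> real) \<Rightarrow> bool" where
  "strictly_spacelike u \<longleftrightarrow> (\<exists>\<beta><1. \<forall>x. norm (gradient u x) \<le> \<beta>)"

definition induced_metric :: "(real^'n::finite \<Rightarrow> real) \<Rightarrow> real^'n \<Rightarrow> real^'n^'n" where
  "induced_metric u x =
    (\<chi> i j. (if i = j then 1 else 0) - partial_deriv i u x * partial_deriv j u x)"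

definition second_fundamental_form :: "(real^'n::finite \<Rightarrow> real) \<Rightarrow> real^'n \<Rightarrow> real^'n^'n" where
  "second_fundamental_form u x =
    (\<chi> i j. partial_deriv j (partial_deriv i u) x / sqrt (1 - (norm (gradient u x))\<^sup>2))"

text \<open>The eigenvalues of the second fundamental form \<open>h\<close> with respect to the metric \<open>g\<close> are the
  roots, with multiplicity, of the polynomial \<open>det (\<lambda> g - h)\<close> in \<open>\<lambda>\<close>, listed here in increasing
  order. For smooth spacelike \<open>u\<close> the matrix \<open>h\<close> is symmetric and \<open>g\<close> is positive definite, so all
  roots of this polynomial, of degree \<open>CARD('n)\<close>, are real and the list has length \<open>CARD('n)\<close>.\<close>

definition principal_curvatures :: "(real^'n::finite \<Rightarrow> real) \<Rightarrow> real^'n \<Rightarrow> real list" where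
  "principal_curvatures u x = sorted_list_of_multiset (proots
     (det (\<chi> i j. [: - second_fundamental_form u x $ i $ j, induced_metric u x $ i $ j :])))"

definition convex_graph :: "(real^'n::finite \<Rightarrow> real) \<Rightarrow> bool" where
  "convex_graph u \<longleftrightarrow> (\<forall>x. \<forall>c \<in> set (principal_curvatures u x). 0 \<le> c)"

definition elem_sym :: "nat \<Rightarrow> 'a::comm_ring_1 list \<Rightarrow> 'a" where
  "elem_sym k xs = (\<Sum>I | I \<subseteq> {..<length xs} \<and> card I = k. \<Prod>i\<in>I. xs ! i)"

end

theory Submission
  imports Defs
begin

text \<open>Compare \<open>u\<close> with the hyperboloid \<open>v x = sqrt (4 + \<bar>x\<bar>\<^sup>2)\<close> of radius 2, all of whose principal
  curvatures are \<open>1/2\<close>. Since \<open>v\<close> has slope 1 at infinity while \<open>u\<close> has slope at most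
  \<open>\<beta> < 1\<close>, the difference \<open>v - u\<close> attains its minimum. There the gradients agree and
  \<open>D\<^sup>2u \<le> D\<^sup>2v\<close>, so the two graphs have the same induced metric and every principal curvature of
  \<open>u\<close> lies in \<open>[0, 1/2]\<close>. Hence \<open>\<sigma>\<^sub>k \<le> (n choose k) / 2 ^ k < (n choose k)\<close>.\<close>

section \<open>Calculus along lines\<close>

text \<open>If \<open>D\<close> were negative, \<open>f'\<close> would be negative just to the right
  of its zero at 0, and the mean value theorem would push \<open>f\<close> below its
  minimum.\<close>

lemma local_min_second_deriv_nonneg:
  fixes f f' :: "real \<Rightarrow> real"
  assumes f: "\<And>t. (f has_real_derivative f' t) (at t)"
    and f': "(f' has_real_derivative D) (at 0)"
    and min: "\<And>t. f 0 \<le> f t"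
  shows "f' 0 = 0" and "0 \<le> D"
proof -
  show z: "f' 0 = 0"
    using DERIV_local_min[OF f[of 0], of 1] min by auto
  show "0 \<le> D"
  proof (rule ccontr)
    assume "\<not> 0 \<le> D"
    then obtain d where d: "d > 0" "\<And>h. 0 < h \<Longrightarrow> h < d \<Longrightarrow> f' h < 0"
      using DERIV_neg_dec_right[OF f'] z by auto
    obtain c where c: "0 < c" "c < d / 2" "f (d / 2) - f 0 = (d / 2 - 0) * f' c"
      using MVT2[of 0 "d / 2" f f'] f d(1) by auto
    moreover have "(d / 2 - 0) * f' c < 0"
      using c(1,2) d by (intro mult_pos_neg) auto
    ultimately have "f (d / 2) < f 0"
      by linarith
    with min[of "d / 2"] show False
      by simp
  qed
qed

lemma frechet_derivative_eq_gradient: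
  fixes f :: "real^'n::finite \<Rightarrow> real"
  assumes "f differentiable (at x)"
  shows "frechet_derivative f (at x) y = gradient f x \<bullet> y"
proof -
  have lin: "linear (frechet_derivative f (at x))"
    using assms by (rule linear_frechet_derivative)
  have "frechet_derivative f (at x) y = frechet_derivative f (at x) (\<Sum>i\<in>UNIV. y $ i *\<^sub>R axis i 1)"
    by (simp add: basis_expansion scalar_mult_eq_scaleR[symmetric])
  also have "\<dots> = (\<Sum>i\<in>UNIV. y $ i * partial_deriv i f x)"
    by (simp add: linear_sum[OF lin] linear_scale[OF lin] partial_deriv_def)
  also have "\<dots> = gradient f x \<bullet> y"
    by (simp add: inner_vec_def gradient_def mult.commute)
  finally show ?thesis .
qed

lemma has_real_derivative_along_line:
  fixes f :: "real^'n::finite \<Rightarrow> real"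
  assumes "\<And>x. f differentiable (at x)"
  shows "((\<lambda>t. f (x + t *\<^sub>R y)) has_real_derivative gradient f (x + t *\<^sub>R y) \<bullet> y) (at t)"
proof -
  let ?F = "frechet_derivative f (at (x + t *\<^sub>R y))"
  have "(f has_derivative ?F) (at (x + t *\<^sub>R y))"
    using assms by (simp flip: frechet_derivative_works)
  moreover have "((\<lambda>t. x + t *\<^sub>R y) has_derivative (\<lambda>s. s *\<^sub>R y)) (at t)"
    by (auto intro!: derivative_eq_intros)
  ultimately have "((\<lambda>t. f (x + t *\<^sub>R y)) has_derivative (\<lambda>s. ?F (s *\<^sub>R y))) (at t)"
    by (rule has_derivative_compose[rotated])
  moreover have "(\<lambda>s. ?F (s *\<^sub>R y)) = (*) (gradient f (x + t *\<^sub>R y) \<bullet> y)"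
    by (simp add: frechet_derivative_eq_gradient[OF assms] fun_eq_iff)
  ultimately show ?thesis
    by (simp add: has_field_derivative_def)
qed

text \<open>Reduces the second-order condition at a minimum to one variable. The Hessian is indexed
  as in \<open>second_fundamental_form\<close>, so that it can be substituted there
  directly.\<close>

lemma has_real_derivative_gradient_along_line:
  fixes f :: "real^'n::finite \<Rightarrow> real"
  assumes "\<And>i x. partial_deriv i f differentiable (at x)"
  shows "((\<lambda>t. gradient f (x + t *\<^sub>R y) \<bullet> y) has_real_derivative
    y \<bullet> ((\<chi> i j. partial_deriv j (partial_deriv i f) (x + t *\<^sub>R y)) *v y)) (at t)"
proof -
  have "((\<lambda>t. \<Sum>i\<in>UNIV. partial_deriv i f (x + t *\<^sub>R y) * y $ i) has_real_derivative
      (\<Sum>i\<in>UNIV. (gradient (partial_deriv i f) (x + t *\<^sub>R y) \<bullet> y) * y $ i)) (at t)"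
    by (intro DERIV_sum DERIV_cmult_right has_real_derivative_along_line assms)
  then show ?thesis
    by (simp add: inner_vec_def gradient_def matrix_vector_mult_def mult.commute)
qed

text \<open>Mean value theorem on the segment from 0 to \<open>x\<close>, followed by
  Cauchy-Schwarz.\<close>

lemma lipschitz_of_gradient_bound:
  fixes f :: "real^'n::finite \<Rightarrow> real"
  assumes "\<And>x. f differentiable (at x)" and "\<And>x. norm (gradient f x) \<le> B"
  shows "f x \<le> f 0 + B * norm x"
proof -
  obtain c where "f (0 + 1 *\<^sub>R x) - f (0 + 0 *\<^sub>R x) = (1 - 0) * (gradient f (0 + c *\<^sub>R x) \<bullet> x)"
    using MVT2[of 0 1, OF _ has_real_derivative_along_line[OF assms(1), of 0 x]] by auto
  moreover have "gradient f (0 + c *\<^sub>R x) \<bullet> x \<le> B * norm x"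
    by (meson assms(2) mult_right_mono norm_cauchy_schwarz norm_ge_zero order_trans)
  ultimately show ?thesis
    by simp
qed

section \<open>The comparison hyperboloid\<close>

definition hyperboloid :: "real \<Rightarrow> 'a::real_inner \<Rightarrow> real" where
  "hyperboloid R x = sqrt (R\<^sup>2 + x \<bullet> x)"

lemma hyperboloid_pos: "R \<noteq> 0 \<Longrightarrow> 0 < hyperboloid R x"
  by (simp add: hyperboloid_def add_pos_nonneg)

lemma hyperboloid_square: "(hyperboloid R x)\<^sup>2 = R\<^sup>2 + x \<bullet> x"
  by (simp add: hyperboloid_def)

lemma norm_le_hyperboloid: "norm x \<le> hyperboloid R x"
  by (simp add: hyperboloid_def norm_eq_sqrt_inner)

lemma has_real_derivative_hyperboloid_along_line:
  assumes "R \<noteq> 0"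
  shows "((\<lambda>t. hyperboloid R (x + t *\<^sub>R y)) has_real_derivative
    ((x + t *\<^sub>R y) \<bullet> y) / hyperboloid R (x + t *\<^sub>R y)) (at t)"
proof -
  have e: "hyperboloid R (x + t *\<^sub>R y) = sqrt (R\<^sup>2 + (x \<bullet> x + 2 * t * (x \<bullet> y) + t\<^sup>2 * (y \<bullet> y)))"
    for t
    by (simp add: hyperboloid_def inner_simps inner_commute power2_eq_square algebra_simps)
  show ?thesis
    using hyperboloid_pos[OF assms, of "x + t *\<^sub>R y"] unfolding e
    by (auto intro!: derivative_eq_intros simp: field_simps inner_simps)
qed

text \<open>The hyperboloid has gradient \<open>x / s\<close>, so the numerator is the quadratic
  form of its induced metric g: its Hessian is g / \<open>s\<close>.\<close>

lemma second_derivative_hyperboloid_along_line: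
  fixes x y :: "'a::real_inner"
  assumes "R \<noteq> 0"
  defines "s \<equiv> hyperboloid R x"
  shows "((\<lambda>t. ((x + t *\<^sub>R y) \<bullet> y) / hyperboloid R (x + t *\<^sub>R y)) has_real_derivative
    (y \<bullet> y - (x \<bullet> y / s)\<^sup>2) / s) (at 0)"
proof -
  have s: "s > 0"
    by (simp add: s_def hyperboloid_pos assms)
  have "((\<lambda>t. ((x + t *\<^sub>R y) \<bullet> y) / hyperboloid R (x + t *\<^sub>R y)) has_real_derivative
      ((y \<bullet> y) * s - (x \<bullet> y) * ((x \<bullet> y) / s)) / (s * s)) (at 0)"
    unfolding inner_add_left inner_scaleR_left
    using has_real_derivative_hyperboloid_along_line[OF assms(1), of x y 0] s
    by (auto intro!: derivative_eq_intros simp: s_def)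
  moreover have "((y \<bullet> y) * s - (x \<bullet> y) * ((x \<bullet> y) / s)) / (s * s) = (y \<bullet> y - (x \<bullet> y / s)\<^sup>2) / s"
    using s by (simp add: field_simps power2_eq_square)
  ultimately show ?thesis
    by simp
qed

text \<open>The hyperboloid lies above \<open>norm x\<close>, while \<open>u\<close> grows at most
  like \<open>B * norm x\<close>. The difference is therefore coercive, and its minimum over a large
  ball is global.\<close>

lemma hyperboloid_touches:
  fixes u :: "real^'n::finite \<Rightarrow> real"
  assumes diff: "\<And>x. u differentiable (at x)"
    and bound: "\<And>x. norm (gradient u x) \<le> B" and "B < 1"
  shows "\<exists>x. \<forall>y. hyperboloid R x - u x \<le> hyperboloid R y - u y"
proof -
  let ?f = "\<lambda>x. hyperboloid R x - u x"
  \<comment> \<open>Chosen so that \<open>norm y > r\<close> forces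
    \<open>(1 - B) * norm y - u 0\<close>, a lower bound of \<open>?f y\<close>, to be at least
    \<open>?f 0\<close>.\<close>
  define r where "r = \<bar>?f 0 + u 0\<bar> / (1 - B)"
  have "continuous_on UNIV u"
    using diff by (simp add: continuous_at_imp_continuous_on differentiable_imp_continuous_within)
  then have "continuous_on (cball 0 r) ?f"
    unfolding hyperboloid_def by (intro continuous_intros) (auto intro: continuous_on_subset)
  moreover have "r \<ge> 0"
    using \<open>B < 1\<close> by (simp add: r_def)
  ultimately obtain x where "\<forall>y\<in>cball 0 r. ?f x \<le> ?f y"
    using continuous_attains_inf[of "cball 0 r" ?f] by auto
  then have x: "?f x \<le> ?f y" if "norm y \<le> r" for y
    using that by simp
  have "?f x \<le> ?f y" if "norm y > r" for y
  proof -
    have "?f x \<le> ?f 0"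
      using x \<open>r \<ge> 0\<close> by simp
    also have "\<dots> \<le> (1 - B) * norm y - u 0"
      using that \<open>B < 1\<close> by (simp add: r_def field_simps)
    also have "\<dots> \<le> ?f y"
      using lipschitz_of_gradient_bound[OF diff bound, of y] norm_le_hyperboloid[of y R]
      by (simp add: algebra_simps)
    finally show ?thesis .
  qed
  with x show ?thesis
    by (meson not_less)
qed

section \<open>Principal curvatures as roots of a determinant\<close>

lemma poly_det:
  fixes M :: "'a::comm_ring_1 poly^'n^'n::finite"
  shows "poly (det M) c = det (\<chi> i j. poly (M $ i $ j) c)"
proof -
  have "poly (of_int m :: 'a poly) c = of_int m" for m
    by (simp add: of_int_poly)
  then show ?thesis
    by (simp add: det_def poly_sum poly_prod)
qed

lemma degree_det_le:
  fixes M :: "'a::comm_ring_1 poly^'n^'n::finite"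
  assumes "\<And>i j. degree (M $ i $ j) \<le> d"
  shows "degree (det M) \<le> d * CARD('n)"
  unfolding det_def
proof (intro degree_sum_le finite_permutations finite)
  fix p :: "'n \<Rightarrow> 'n"
  have "degree (of_int (sign p) * (\<Prod>i\<in>UNIV. M $ i $ p i)) \<le> degree (\<Prod>i\<in>UNIV. M $ i $ p i)"
    using degree_mult_le[of "of_int (sign p)" "\<Prod>i\<in>UNIV. M $ i $ p i"] by simp
  also have "\<dots> \<le> (\<Sum>i\<in>UNIV. degree (M $ i $ p i))"
    using degree_prod_sum_le[of UNIV "\<lambda>i. M $ i $ p i"] by (simp add: o_def)
  also have "\<dots> \<le> d * CARD('n)"
    using sum_mono[of UNIV "\<lambda>i. degree (M $ i $ p i)" "\<lambda>_. d"] assms by (simp add: mult.commute)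
  finally show "degree (of_int (sign p) * (\<Prod>i\<in>UNIV. M $ i $ p i)) \<le> d * CARD('n)" .
qed

text \<open>The determinant has entries of degree at most 1. An upper bound on the number of roots
  suffices for the final estimate, since \<open>length xs choose k\<close> increases with the
  length.\<close>

lemma length_principal_curvatures_le:
  fixes u :: "real^'n::finite \<Rightarrow> real"
  shows "length (principal_curvatures u x) \<le> CARD('n)"
proof -
  let ?p = "det (\<chi> i j. [: - second_fundamental_form u x $ i $ j, induced_metric u x $ i $ j :])"
  have "length (principal_curvatures u x) = size (proots ?p)"
    by (simp add: principal_curvatures_def flip: size_mset)
  also have "\<dots> \<le> degree ?p"
    by (rule size_proots_le)
  also have "\<dots> \<le> CARD('n)"
    by (rule order_trans[OF degree_det_le[where d = 1]]) simp_all
  finally show ?thesis .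
qed

lemma principal_curvature_eigenvector:
  assumes "c \<in> set (principal_curvatures u x)"
  obtains y where "y \<noteq> 0"
    "second_fundamental_form u x *v y = c *\<^sub>R (induced_metric u x *v y)"
proof -
  let ?p = "det (\<chi> i j. [: - second_fundamental_form u x $ i $ j, induced_metric u x $ i $ j :])"
  have c: "c \<in># proots ?p"
    using assms by (simp add: principal_curvatures_def)
  \<comment> \<open>\<open>proots 0\<close> is empty by convention, so having a member excludes the
    zero polynomial.\<close>
  then have "?p \<noteq> 0"
    by auto
  with c have "poly ?p c = 0"
    by simp
  then have "det (c *\<^sub>R induced_metric u x - second_fundamental_form u x) = 0"
    by (simp add: poly_det minus_vec_def scaleR_vec_def)
  then obtain y where "y \<noteq> 0" "(c *\<^sub>R induced_metric u x - second_fundamental_form u x) *v y = 0"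
    by (metis invertible_det_nz invertible_left_inverse matrix_left_invertible_ker)
  with that show thesis
    by (simp add: matrix_vector_mult_diff_rdistrib scaleR_matrix_vector_assoc)
qed

lemma induced_metric_quadratic_form:
  "y \<bullet> (induced_metric u x *v y) = y \<bullet> y - (gradient u x \<bullet> y)\<^sup>2"
proof -
  have "induced_metric u x *v y = y - (gradient u x \<bullet> y) *\<^sub>R gradient u x"
    by (simp add: vec_eq_iff matrix_vector_mult_def induced_metric_def right_diff_distrib
        sum_subtractf if_distrib[of "\<lambda>c. _ * c"] inner_vec_def gradient_def sum_distrib_left
        sum_distrib_right mult_ac cong: if_cong)
  then show ?thesis
    by (simp add: inner_diff_right power2_eq_square inner_commute)
qed

text \<open>Cauchy-Schwarz, strict because \<open>y\<close> is nonzero. Positivity later allows this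
  form to be cancelled from an inequality.\<close>

lemma induced_metric_pos_def:
  assumes "norm (gradient u x) < 1" and "y \<noteq> 0"
  shows "0 < y \<bullet> (induced_metric u x *v y)"
proof -
  have "\<bar>gradient u x \<bullet> y\<bar> \<le> norm (gradient u x) * norm y"
    by (rule Cauchy_Schwarz_ineq2)
  also have "\<dots> < norm y"
    using assms by simp
  finally have "(gradient u x \<bullet> y)\<^sup>2 < (norm y)\<^sup>2"
    by (metis abs_ge_zero power2_abs power_strict_mono zero_less_numeral)
  then show ?thesis
    by (simp add: induced_metric_quadratic_form power2_norm_eq_inner)
qed

section \<open>Comparison at the touching point\<close>

text \<open>Pairing the eigenvector equation with its eigenvector \<open>y\<close> writes
  \<open>c\<close> as a quotient of the two fundamental forms of \<open>u\<close>, which touching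
  bounds by the constant quotient \<open>1 / R\<close> of the hyperboloid.\<close>

lemma principal_curvature_le_of_hyperboloid_touching:
  fixes u :: "real^'n::finite \<Rightarrow> real"
  assumes diff: "\<And>x. u differentiable (at x)"
    and diff2: "\<And>i x. partial_deriv i u differentiable (at x)"
    and grad: "norm (gradient u x) < 1" and R: "R > 0"
    and touch: "\<And>y. hyperboloid R x - u x \<le> hyperboloid R y - u y"
    and c: "c \<in> set (principal_curvatures u x)"
  shows "c \<le> 1 / R"
proof -
  let ?s = "hyperboloid R x"
  let ?H = "(\<chi> i j. partial_deriv j (partial_deriv i u) x)"
  have s: "?s > 0"
    using R by (simp add: hyperboloid_pos)
  have R2: "R\<^sup>2 = ?s\<^sup>2 - x \<bullet> x"
    by (simp add: hyperboloid_square)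
  \<comment> \<open>First- and second-order conditions at \<open>t = 0\<close> for the difference
    restricted to the line through \<open>x\<close> in direction \<open>y\<close>.\<close>
  have min: "(x \<bullet> y) / ?s = gradient u x \<bullet> y"
      "0 \<le> (y \<bullet> y - (x \<bullet> y / ?s)\<^sup>2) / ?s - y \<bullet> (?H *v y)" for y
    using local_min_second_deriv_nonneg[of "\<lambda>t. hyperboloid R (x + t *\<^sub>R y) - u (x + t *\<^sub>R y)"
        "\<lambda>t. ((x + t *\<^sub>R y) \<bullet> y) / hyperboloid R (x + t *\<^sub>R y) - gradient u (x + t *\<^sub>R y) \<bullet> y"
        "(y \<bullet> y - (x \<bullet> y / ?s)\<^sup>2) / ?s - y \<bullet> (?H *v y)"]
      R touch
      DERIV_diff[OF has_real_derivative_hyperboloid_along_line[of R x y]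
        has_real_derivative_along_line[OF diff, of x y]]
      DERIV_diff[OF second_derivative_hyperboloid_along_line[of R x y]
        has_real_derivative_gradient_along_line[OF diff2, of x y 0]]
    by auto
  have "gradient u x = x /\<^sub>R ?s"
    by (rule vector_eq_rdot[THEN iffD1]) (use min(1) in \<open>simp add: divide_inverse mult.commute\<close>)
  then have "(norm (gradient u x))\<^sup>2 = (x \<bullet> x) / ?s\<^sup>2"
    by (simp add: power_mult_distrib power2_norm_eq_inner divide_inverse power_inverse mult.commute)
  also have "1 - \<dots> = (R / ?s)\<^sup>2"
    using s by (simp add: R2 power_divide diff_divide_distrib)
  finally have w: "sqrt (1 - (norm (gradient u x))\<^sup>2) = R / ?s"
    using R s by simp
  obtain y where y: "y \<noteq> 0"
      "second_fundamental_form u x *v y = c *\<^sub>R (induced_metric u x *v y)"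
    using principal_curvature_eigenvector[OF c] by blast
  have "second_fundamental_form u x = (?s / R) *\<^sub>R ?H"
    unfolding second_fundamental_form_def w by (simp add: vec_eq_iff)
  then have "c * (y \<bullet> (induced_metric u x *v y)) = (?s / R) * (y \<bullet> (?H *v y))"
    using y(2) by (metis inner_scaleR_right scaleR_matrix_vector_assoc)
  also have "\<dots> \<le> (?s / R) * ((y \<bullet> y - (x \<bullet> y / ?s)\<^sup>2) / ?s)"
    using min(2)[of y] R s by (intro mult_left_mono) auto
  \<comment> \<open>By the first-order condition the hyperboloid's metric form is that of
    \<open>u\<close>, and the factors \<open>?s\<close> cancel.\<close>
  also have "\<dots> = 1 / R * (y \<bullet> (induced_metric u x *v y))"
    using s by (simp add: min(1) induced_metric_quadratic_form)
  finally show ?thesis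
    using induced_metric_pos_def[OF grad y(1)] mult_le_cancel_right_pos by blast
qed

text \<open>Nonnegative entries make each product over a \<open>k\<close>-subset at most
  \<open>b ^ k\<close>; the binomial coefficient counts these subsets.\<close>

lemma elem_sym_le:
  fixes xs :: "real list"
  assumes "\<And>c. c \<in> set xs \<Longrightarrow> 0 \<le> c \<and> c \<le> b"
  shows "elem_sym k xs \<le> real (length xs choose k) * b ^ k"
proof -
  have "elem_sym k xs \<le> (\<Sum>I | I \<subseteq> {..<length xs} \<and> card I = k. b ^ k)"
    unfolding elem_sym_def
  proof (rule sum_mono)
    fix I assume I: "I \<in> {I. I \<subseteq> {..<length xs} \<and> card I = k}"
    then have "(\<Prod>i\<in>I. xs ! i) \<le> (\<Prod>i\<in>I. b)"
      using assms by (intro prod_mono) auto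
    with I show "(\<Prod>i\<in>I. xs ! i) \<le> b ^ k"
      by simp
  qed
  then show ?thesis
    by (simp add: n_subsets)
qed

theorem corollary2:
  fixes k :: nat
  assumes "1 < k" and "k < CARD('n::finite)"
  shows "\<not> (\<exists>u :: real^'n \<Rightarrow> real.
            smooth u \<and> spacelike u \<and> convex_graph u \<and>
            (\<forall>x. elem_sym k (principal_curvatures u x) = real (CARD('n) choose k)) \<and>
            strictly_spacelike u)"
proof
  assume "\<exists>u :: real^'n \<Rightarrow> real.
            smooth u \<and> spacelike u \<and> convex_graph u \<and>
            (\<forall>x. elem_sym k (principal_curvatures u x) = real (CARD('n) choose k)) \<and>
            strictly_spacelike u"
  then obtain u :: "real^'n \<Rightarrow> real" and B where
    sm: "smooth u" and sp: "\<And>x. norm (gradient u x) < 1" and cv: "convex_graph u"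
    and eq: "\<And>x. elem_sym k (principal_curvatures u x) = real (CARD('n) choose k)"
    and B: "B < 1" "\<And>x. norm (gradient u x) \<le> B"
    by (auto simp: spacelike_def strictly_spacelike_def)
  have "C_k (Suc (Suc 0)) u"
    using sm unfolding smooth_def by blast
  then have diff: "u differentiable (at x)" "partial_deriv i u differentiable (at x)" for i x
    by auto
  \<comment> \<open>Any radius above 1 would serve, as it bounds the curvatures by a number below
    1.\<close>
  obtain x where x: "\<And>y. hyperboloid 2 x - u x \<le> hyperboloid 2 y - u y"
    using hyperboloid_touches[OF diff(1) B(2,1), of 2] by blast
  have "0 \<le> c \<and> c \<le> 1 / 2" if "c \<in> set (principal_curvatures u x)" for c
    using principal_curvature_le_of_hyperboloid_touching[OF diff sp _ x that] cv that
    by (auto simp: convex_graph_def)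
  then have "real (CARD('n) choose k) \<le> real (length (principal_curvatures u x) choose k) * (1 / 2) ^ k"
    unfolding eq[of x, symmetric] by (rule elem_sym_le)
  also have "\<dots> \<le> real (CARD('n) choose k) * (1 / 2) ^ k"
    by (intro mult_right_mono of_nat_mono binomial_right_mono length_principal_curvatures_le) auto
  \<comment> \<open>The bounds on \<open>k\<close> make the binomial coefficient positive and
    \<open>(1 / 2) ^ k\<close> less than 1.\<close>
  also have "\<dots> < real (CARD('n) choose k) * 1"
    using assms by (intro mult_strict_left_mono power_Suc_less_one) (auto simp: power_less_one_iff)
  finally show False
    by simp
qed

end
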